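(* For nonnegative integers $a,b,c$ with $b\ge a+c$, $$B_1^{(a)}B_2^{(b)}B_1^{(c)}\eta=\sum_{t=0}^a\sum_{l=b-c}^{b}\varsigma_1^{a-t}\varsigma_2^{b-l}q^{-(b-l)(-b-l+1+2c+2n)/2-(a-t)(2m+4b-4c-2l-a-t+1)/2}\begin{bmatrix}n+a-t-b+c\\ a-t\end{bmatrix}\begin{bmatrix}m-c+b-l\\ b-l\end{bmatrix}F_1^{(t)}F_2^{(l-a+t)}F_1^{(c-b+l)}\eta.$$ Equivalently, $$B_1^{(a)}B_2^{(b)}B_1^{(c)}\eta=\sum_{x=0}^a\sum_{y=0}^{c}\varsigma_1^{x}\varsigma_2^{y}q^{-y(y+1+2n+2c-2b)/2-x(x+1+2m+2b-4c-2a-2y)/2}\begin{bmatrix}n-b+c+x\\ x\end{bmatrix}\begin{bmatrix}m-c+y\\ y\end{bmatrix}F_1^{(a-x)}F_2^{(b-x-y)}F_1^{(c-y)}\eta.$$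
   Context: $\mathbf U=\mathbf U_q(\mathfrak{sl}_3)$ over $\mathbb F$, the algebraic closure of $\mathbb Q(q)$, with Chevalley generators $E_a,F_a,K_a^{\pm1}$ ($a=1,2$), $[E_a,F_b]=\delta_{ab}\frac{K_a-K_a^{-1}}{q-q^{-1}}$. For $\varsigma_1,\varsigma_2\in\mathbb F^\times$ arbitrary, $\mathbf U^\imath(\mathfrak{sl}_3)\subset\mathbf U$ is the quasi-split iquantum group generated by $B_1=F_1+\varsigma_1E_2K_1^{-1}$, $B_2=F_2+\varsigma_2E_1K_2^{-1}$, $k_1=K_1K_2^{-1}$ and $k_1^{-1}$. $[r]=\frac{q^r-q^{-r}}{q-q^{-1}}$; $\begin{bmatrix}N\\ r\end{bmatrix}=\prod_{s=1}^r\frac{[N-s+1]}{[s]}$ for $N\in\mathbb Z$, $r\in\mathbb N$. Divided powers: $F_a^{(r)}=F_a^r/[r]!$, $B_a^{(r)}=B_a^r/[r]!$ (zero for $r<0$). $L(m,n)$ ($m,n\in\mathbb N$) is the simple $\mathbf U$-module with highest weight $m\omega_1+n\omega_2$ ($\omega_1,\omega_2$ the fundamental weights) and $\eta$ is its highest weight vector. The identities hold in $L(m,n)$.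
   Formalization: In the second displayed formula the exponent of q has -x(x+1+2m+2b-4c-2a+2y)/2 instead of the printed -2y; the printed sign disagrees with the first formula and fails e.g. for m=n=a=c=1, b=2. *)

theory Defs
  imports
    "HOL-Library.Poly_Mapping"
    "HOL-Computational_Algebra.Polynomial"
    "HOL-Computational_Algebra.Fraction_Field"
    "HOL-Algebra.Algebraic_Closure_Type"
begin

section \<open>The ground field and quantum integers\<close>

type_synonym qfield = "rat poly fract alg_closure"

definition q :: qfield where
  "q = to_ac (Fract [:0, 1:] 1)"

definition qint :: "int \<Rightarrow> qfield" where
  "qint r = (q powi r - q powi (- r)) / (q - inverse q)"

definition qfact :: "nat \<Rightarrow> qfield" where
  "qfact r = (\<Prod>s = 1..r. qint (int s))"

definition qbinom :: "int \<Rightarrow> nat \<Rightarrow> qfield" where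
  "qbinom N r = (\<Prod>s = 1..r. qint (N - int s + 1) / qint (int s))"


section \<open>The free associative algebra\<close>

datatype vertex = v1 | v2

datatype gen = gE vertex | gF vertex | gK vertex | gKinv vertex

datatype word = Word (letters: "gen list")

instantiation word :: monoid_add
begin

definition zero_word :: word where "zero_word = Word []"

definition plus_word :: "word \<Rightarrow> word \<Rightarrow> word" where
  "plus_word u w = Word (letters u @ letters w)"

instance
  by standard (simp_all add: zero_word_def plus_word_def)

end

text \<open>
  Words form a monoid under concatenation (written additively), so multiplication of finitely
  supported functions on words is the convolution product, that is, the product of the free algebra.
\<close>

type_synonym free_alg = "word \<Rightarrow>\<^sub>0 qfield"

definition fgen :: "gen \<Rightarrow> free_alg" where
  "fgen g = Poly_Mapping.single (Word [g]) 1"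

definition fscal :: "qfield \<Rightarrow> free_alg" where
  "fscal c = Poly_Mapping.single 0 c"


section \<open>The algebra $U_q(sl_3)$ by generators and relations\<close>

definition cartan :: "vertex \<Rightarrow> vertex \<Rightarrow> int" where
  "cartan a b = (if a = b then 2 else - 1)"

definition serre_poly :: "free_alg \<Rightarrow> free_alg \<Rightarrow> free_alg" where
  "serre_poly x y = x ^ 2 * y - fscal (qint 2) * (x * y * x) + y * x ^ 2"

text \<open>An element of this set stands for the relation that it vanishes.\<close>

inductive_set uq_rels :: "free_alg set" where
  K_Kinv: "fgen (gK a) * fgen (gKinv a) - 1 \<in> uq_rels"
| Kinv_K: "fgen (gKinv a) * fgen (gK a) - 1 \<in> uq_rels"
| K_K: "fgen (gK a) * fgen (gK b) - fgen (gK b) * fgen (gK a) \<in> uq_rels"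
| K_E: "fgen (gK a) * fgen (gE b)
          - fscal (q powi cartan a b) * (fgen (gE b) * fgen (gK a)) \<in> uq_rels"
| K_F: "fgen (gK a) * fgen (gF b)
          - fscal (q powi (- cartan a b)) * (fgen (gF b) * fgen (gK a)) \<in> uq_rels"
| E_F_same: "fgen (gE a) * fgen (gF a) - fgen (gF a) * fgen (gE a)
          - fscal (inverse (q - inverse q)) * (fgen (gK a) - fgen (gKinv a)) \<in> uq_rels"
| E_F_diff: "a \<noteq> b \<Longrightarrow> fgen (gE a) * fgen (gF b) - fgen (gF b) * fgen (gE a) \<in> uq_rels"
| Serre_E: "a \<noteq> b \<Longrightarrow> serre_poly (fgen (gE a)) (fgen (gE b)) \<in> uq_rels"
| Serre_F: "a \<noteq> b \<Longrightarrow> serre_poly (fgen (gF a)) (fgen (gF b)) \<in> uq_rels"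

inductive_set uq_ideal :: "free_alg set" where
  zero: "0 \<in> uq_ideal"
| add: "x \<in> uq_ideal \<Longrightarrow> y \<in> uq_ideal \<Longrightarrow> x + y \<in> uq_ideal"
| gen: "r \<in> uq_rels \<Longrightarrow> u * r * w \<in> uq_ideal"

lemma uq_ideal_mult_left: "x \<in> uq_ideal \<Longrightarrow> u * x \<in> uq_ideal"
proof (induction rule: uq_ideal.induct)
  case (gen r v w)
  have "(u * v) * r * w \<in> uq_ideal"
    by (rule uq_ideal.gen) (rule gen)
  then show ?case by (simp add: mult.assoc)
qed (auto intro: uq_ideal.intros simp: distrib_left)

lemma uq_ideal_mult_right: "x \<in> uq_ideal \<Longrightarrow> x * u \<in> uq_ideal"
proof (induction rule: uq_ideal.induct)
  case (gen r v w)
  have "v * r * (w * u) \<in> uq_ideal"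
    by (rule uq_ideal.gen) (rule gen)
  then show ?case by (simp add: mult.assoc)
qed (auto intro: uq_ideal.intros simp: distrib_right)

lemma uq_ideal_uminus: "x \<in> uq_ideal \<Longrightarrow> - x \<in> uq_ideal"
  using uq_ideal_mult_left[of x "- 1"] by simp

lemma uq_rels_in_ideal: "r \<in> uq_rels \<Longrightarrow> r \<in> uq_ideal"
  using uq_ideal.gen[of r 1 1] by simp

text \<open>
  The quotient by this ideal is nonzero: the counit, which sends a word to 1 if it only consists
  of letters \<open>gK\<close>, \<open>gKinv\<close> and to 0 otherwise, kills the ideal.
\<close>

definition word_counit :: "word \<Rightarrow> qfield" where
  "word_counit w = (if \<forall>g\<in>set (letters w). \<exists>a. g = gK a \<or> g = gKinv a then 1 else 0)"

definition counit :: "free_alg \<Rightarrow> qfield" where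
  "counit x = (\<Sum>w\<in>Poly_Mapping.keys x. Poly_Mapping.lookup x w * word_counit w)"

lemma counit_superset:
  assumes "finite S" "Poly_Mapping.keys x \<subseteq> S"
  shows "counit x = (\<Sum>w\<in>S. Poly_Mapping.lookup x w * word_counit w)"
  unfolding counit_def
  by (rule sum.mono_neutral_left) (use assms in \<open>auto simp: in_keys_iff\<close>)

lemma counit_add: "counit (x + y) = counit x + counit y"
proof -
  let ?S = "Poly_Mapping.keys x \<union> Poly_Mapping.keys y"
  have "counit (x + y) = (\<Sum>w\<in>?S. Poly_Mapping.lookup (x + y) w * word_counit w)"
    by (rule counit_superset) (use keys_add[of x y] in auto)
  moreover have "counit x = (\<Sum>w\<in>?S. Poly_Mapping.lookup x w * word_counit w)"
    by (rule counit_superset) auto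
  moreover have "counit y = (\<Sum>w\<in>?S. Poly_Mapping.lookup y w * word_counit w)"
    by (rule counit_superset) auto
  ultimately show ?thesis
    by (simp add: lookup_add distrib_right sum.distrib)
qed

lemma counit_single: "counit (Poly_Mapping.single w c) = c * word_counit w"
  by (cases "c = 0") (simp_all add: counit_def)

lemma counit_zero: "counit 0 = 0"
  by (simp add: counit_def)

lemma counit_diff: "counit (x - y) = counit x - counit y"
  using counit_add[of "x - y" y] by simp

lemma free_alg_induct [case_names zero add]:
  assumes "P 0"
    and step: "\<And>x w c. P x \<Longrightarrow> P (x + Poly_Mapping.single w c)"
  shows "P (x :: free_alg)"
proof (induction x rule: update_induct)
  case const
  then show ?case by (rule assms)
next
  case (update x w c)
  have "Poly_Mapping.update w c x = x + Poly_Mapping.single w c"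
    using update by (intro poly_mapping_eqI)
      (auto simp: lookup_update lookup_add lookup_single in_keys_iff when_def)
  with step update show ?case by simp
qed

lemma word_counit_plus: "word_counit (u + w) = word_counit u * word_counit w"
  by (auto simp: word_counit_def plus_word_def)

lemma counit_mult: "counit (x * y) = counit x * counit y"
proof (induction x rule: free_alg_induct)
  case zero
  then show ?case by (simp add: counit_zero)
next
  case (add x u c)
  have "counit (Poly_Mapping.single u c * y) = counit (Poly_Mapping.single u c) * counit y"
    by (induction y rule: free_alg_induct)
      (simp_all add: counit_zero counit_add counit_single mult_single word_counit_plus
        distrib_left mult_ac)
  with add show ?case by (simp add: distrib_right counit_add)
qed

lemma counit_fscal: "counit (fscal c) = c"
  by (simp add: fscal_def counit_single word_counit_def zero_word_def)

lemma counit_one: "counit 1 = 1"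
  using counit_fscal[of 1] by (simp add: fscal_def)

lemma counit_fgen:
  "counit (fgen (gE a)) = 0" "counit (fgen (gF a)) = 0"
  "counit (fgen (gK a)) = 1" "counit (fgen (gKinv a)) = 1"
  by (simp_all add: fgen_def counit_single word_counit_def)

lemma counit_uq_rels: "r \<in> uq_rels \<Longrightarrow> counit r = 0"
  by (induction rule: uq_rels.induct)
    (simp_all add: serre_poly_def power2_eq_square counit_add counit_diff counit_mult
      counit_one counit_fgen)

lemma counit_uq_ideal: "x \<in> uq_ideal \<Longrightarrow> counit x = 0"
  by (induction rule: uq_ideal.induct)
    (simp_all add: counit_zero counit_add counit_mult counit_uq_rels)

lemma one_notin_uq_ideal: "1 \<notin> uq_ideal"
  using counit_uq_ideal[of 1] by (auto simp: counit_one)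

definition uq_eq :: "free_alg \<Rightarrow> free_alg \<Rightarrow> bool" where
  "uq_eq x y \<longleftrightarrow> x - y \<in> uq_ideal"

lemma equivp_uq_eq: "equivp uq_eq"
proof (rule equivpI)
  show "reflp uq_eq"
    by (auto intro!: reflpI uq_ideal.zero simp: uq_eq_def)
  show "symp uq_eq"
  proof (rule sympI)
    fix x y assume "uq_eq x y"
    then show "uq_eq y x"
      using uq_ideal_uminus[of "x - y"] by (simp add: uq_eq_def)
  qed
  show "transp uq_eq"
  proof (rule transpI)
    fix x y z assume "uq_eq x y" "uq_eq y z"
    then show "uq_eq x z"
      using uq_ideal.add[of "x - y" "y - z"] by (simp add: uq_eq_def)
  qed
qed

quotient_type Uq = free_alg / uq_eq
  by (rule equivp_uq_eq)

instantiation Uq :: ring_1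
begin

lift_definition zero_Uq :: Uq is 0 .

lift_definition one_Uq :: Uq is 1 .

lift_definition plus_Uq :: "Uq \<Rightarrow> Uq \<Rightarrow> Uq" is "(+)"
proof -
  fix x x' y y' assume "uq_eq x x'" "uq_eq y y'"
  then show "uq_eq (x + y) (x' + y')"
    using uq_ideal.add[of "x - x'" "y - y'"] by (simp add: uq_eq_def algebra_simps)
qed

lift_definition uminus_Uq :: "Uq \<Rightarrow> Uq" is uminus
proof -
  fix x x' assume "uq_eq x x'"
  then show "uq_eq (- x) (- x')"
    using uq_ideal_uminus[of "x - x'"] by (simp add: uq_eq_def)
qed

lift_definition minus_Uq :: "Uq \<Rightarrow> Uq \<Rightarrow> Uq" is "(-)"
proof -
  fix x x' y y' assume "uq_eq x x'" "uq_eq y y'"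
  then show "uq_eq (x - y) (x' - y')"
    using uq_ideal.add[of "x - x'" "- (y - y')"] uq_ideal_uminus[of "y - y'"]
    by (simp add: uq_eq_def algebra_simps)
qed

lift_definition times_Uq :: "Uq \<Rightarrow> Uq \<Rightarrow> Uq" is "(*)"
proof -
  fix x x' y y' assume "uq_eq x x'" "uq_eq y y'"
  then have "(x - x') * y + x' * (y - y') \<in> uq_ideal"
    by (intro uq_ideal.add uq_ideal_mult_left uq_ideal_mult_right) (simp_all add: uq_eq_def)
  then show "uq_eq (x * y) (x' * y')"
    by (simp add: uq_eq_def algebra_simps)
qed

instance
proof
  fix x y z :: Uq
  show "x + y + z = x + (y + z)" by transfer (simp add: uq_eq_def uq_ideal.zero add.assoc)
  show "x + y = y + x" by transfer (simp add: uq_eq_def uq_ideal.zero add.commute)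
  show "0 + x = x" by transfer (simp add: uq_eq_def uq_ideal.zero)
  show "- x + x = 0" by transfer (simp add: uq_eq_def uq_ideal.zero)
  show "x - y = x + - y" by transfer (simp add: uq_eq_def uq_ideal.zero)
  show "x * y * z = x * (y * z)" by transfer (simp add: uq_eq_def uq_ideal.zero mult.assoc)
  show "1 * x = x" by transfer (simp add: uq_eq_def uq_ideal.zero)
  show "x * 1 = x" by transfer (simp add: uq_eq_def uq_ideal.zero)
  show "(x + y) * z = x * z + y * z"
    by transfer (simp add: uq_eq_def uq_ideal.zero distrib_right)
  show "x * (y + z) = x * y + x * z"
    by transfer (simp add: uq_eq_def uq_ideal.zero distrib_left)
  show "(0 :: Uq) \<noteq> 1"
  proof transfer
    show "\<not> uq_eq 0 1"
      using uq_ideal_uminus[of "- 1"] one_notin_uq_ideal by (auto simp: uq_eq_def)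
  qed
qed

end

lift_definition scal :: "qfield \<Rightarrow> Uq" is fscal .

lift_definition E :: "vertex \<Rightarrow> Uq" is "\<lambda>a. fgen (gE a)" .

lift_definition F :: "vertex \<Rightarrow> Uq" is "\<lambda>a. fgen (gF a)" .

lift_definition K :: "vertex \<Rightarrow> Uq" is "\<lambda>a. fgen (gK a)" .

lift_definition Kinv :: "vertex \<Rightarrow> Uq" is "\<lambda>a. fgen (gKinv a)" .

definition divpow :: "Uq \<Rightarrow> int \<Rightarrow> Uq" where
  "divpow u r = (if r < 0 then 0 else scal (inverse (qfact (nat r))) * u ^ nat r)"


section \<open>The generators $B_1$, $B_2$ of the iquantum group\<close>

definition B1 :: "qfield \<Rightarrow> Uq" where
  "B1 \<sigma>1 = F v1 + scal \<sigma>1 * (E v2 * Kinv v1)"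

definition B2 :: "qfield \<Rightarrow> Uq" where
  "B2 \<sigma>2 = F v2 + scal \<sigma>2 * (E v1 * Kinv v2)"


section \<open>The modules $L(m,n)$\<close>

text \<open>
  A unital left module; the vector space structure over the ground field is the one coming from
  the scalars inside the algebra.
\<close>

locale Uq_module =
  fixes act :: "Uq \<Rightarrow> 'v::ab_group_add \<Rightarrow> 'v"
  assumes act_add_left: "act (u + w) x = act u x + act w x"
    and act_add_right: "act u (x + y) = act u x + act u y"
    and act_mult: "act (u * w) x = act u (act w x)"
    and act_one: "act 1 x = x"
begin

definition submodule :: "'v set \<Rightarrow> bool" where
  "submodule W \<longleftrightarrow> 0 \<in> W \<and> (\<forall>x\<in>W. \<forall>y\<in>W. x + y \<in> W) \<and> (\<forall>u. \<forall>x\<in>W. act u x \<in> W)"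

end

locale simple_Uq_module = Uq_module act
  for act :: "Uq \<Rightarrow> 'v::ab_group_add \<Rightarrow> 'v" +
  assumes nontrivial: "\<exists>x :: 'v. x \<noteq> 0"
    and submodule_trivial: "submodule W \<Longrightarrow> W = {0} \<or> W = UNIV"

text \<open>
  The simple module with highest weight $m\omega_1 + n\omega_2$ (determined up to isomorphism),
  on the type \<open>'v\<close>, together with a highest weight vector.
\<close>

locale L_module = simple_Uq_module act
  for act :: "Uq \<Rightarrow> 'v::ab_group_add \<Rightarrow> 'v" +
  fixes m n :: nat and \<eta> :: 'v
  assumes \<eta>_nonzero: "\<eta> \<noteq> 0"
    and E_\<eta>: "act (E a) \<eta> = 0"
    and K1_\<eta>: "act (K v1) \<eta> = act (scal (q ^ m)) \<eta>"
    and K2_\<eta>: "act (K v2) \<eta> = act (scal (q ^ n)) \<eta>"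


section \<open>Integrality of the exponents of $q$\<close>

text \<open>
  The exponents in the identities are halves of integers of the following forms, so integer
  division by 2 is exact there.
\<close>

lemma exponent_even:
  "even ((int b - int l) * (- int b - int l + 1 + 2 * int c + 2 * int n))"
  and "even ((int a - int t) * (2 * int m + 4 * int b - 4 * int c - 2 * int l
           - int a - int t + 1))"
  and "even (int u * (int u + 1 + 2 * int n + 2 * int c - 2 * int b))"
  and "even (int v * (int v + 1 + 2 * int m + 2 * int b - 4 * int c - 2 * int a + 2 * int u))"
  by auto

end

theory Submission
  imports Defs
begin

text \<open>
  For \<open>a \<noteq> b\<close> the element \<open>E\<^sub>b\<close> commutes with \<open>F\<^sub>a\<close>, and it kills \<open>\<eta>\<close>. Hence the first factor only produces
  \<open>F\<^sub>1\<^bsup>(c)\<^esup>\<eta>\<close>, and each of the other two divided powers acts on a family of vectors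
  \<open>v t l\<close> (\<open>t\<close> and \<open>l\<close> being the exponents of the outer two divided powers of Chevalley generators)
  by a rule with two terms, one raising \<open>t\<close> and one lowering \<open>l\<close>. Iterating such a rule gives a
  \<open>q\<close>-binomial expansion; applying this expansion twice yields the double sum.
\<close>

section \<open>Quantum integers\<close>

lemma to_ac_power: "to_ac x ^ k = to_ac (x ^ k)"
  by (induction k) simp_all

lemma Fract_X_power: "Fract [:0, 1:] 1 ^ k = Fract (monom (1 :: rat) k) 1"
  by (induction k) (simp_all add: One_fract_def monom_Suc)

lemma q_nonzero: "q \<noteq> 0"
  by (simp add: q_def Zero_fract_def eq_fract)

text \<open>A positive power of the indeterminate is a monomial of positive degree, hence not 1, and
  the embeddings into the fraction field and its algebraic closure are injective. So
  \<open>q\<close> is not a root of unity.\<close>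

lemma q_power_neq_1:
  assumes "k > 0"
  shows "q ^ k \<noteq> 1"
proof
  assume "q ^ k = 1"
  then have "to_ac (Fract (monom (1 :: rat) k) 1) = to_ac 1"
    by (simp add: q_def to_ac_power Fract_X_power)
  then have "Fract (monom (1 :: rat) k) 1 = 1"
    by (simp only: to_ac_eq_iff)
  then have "monom (1 :: rat) k = 1"
    by (simp add: One_fract_def eq_fract)
  then have "degree (monom (1 :: rat) k) = 0"
    by simp
  with assms show False
    by (simp add: degree_monom_eq)
qed

lemma q_diff_nonzero: "q - inverse q \<noteq> 0"
proof
  assume "q - inverse q = 0"
  then have "q ^ 2 = 1"
    using q_nonzero by (simp add: power2_eq_square field_simps)
  then show False
    using q_power_neq_1[of 2] by simp
qed

lemma qint_0 [simp]: "qint 0 = 0"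
  by (simp add: qint_def)

text \<open>A zero would force \<open>q ^ (2 * k) = 1\<close>. Thanks to this, identities between
  vectors can be proved after scaling by a quantum integer, which is then cancelled.\<close>

lemma qint_nonzero:
  assumes "k > 0"
  shows "qint (int k) \<noteq> 0"
proof
  assume "qint (int k) = 0"
  then have "q ^ k = inverse (q ^ k)"
    using q_diff_nonzero by (simp add: qint_def power_int_minus)
  then have "q ^ (2 * k) = 1"
    using q_nonzero by (simp add: mult_2 power_add) (simp add: field_simps)
  then show False
    using q_power_neq_1[of "2 * k"] assms by simp
qed

text \<open>The mixed power \<open>q powi (x - y)\<close> is added and subtracted. This is the
  source of the q-Pascal rule for the expansion coefficients below.\<close>

lemma qint_add: "qint (x + y) = qint x * q powi (- y) + qint y * q powi x"
proof -
  define u u' w w' where "u = q powi x" and "u' = q powi (- x)"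
    and "w = q powi y" and "w' = q powi (- y)"
  have "q powi (x + y) = u * w" "q powi (- (x + y)) = u' * w'"
    using q_nonzero
    by (simp_all add: u_def u'_def w_def w'_def power_int_add power_int_diff power_int_minus
        field_simps)
  then show ?thesis
    unfolding qint_def u_def[symmetric] u'_def[symmetric] w_def[symmetric] w'_def[symmetric]
    by (simp add: diff_divide_distrib algebra_simps)
qed

text \<open>This is the scalar identity behind the induction that moves \<open>E a\<close> past a
  divided power of \<open>F a\<close>.\<close>

lemma qint_mult_shift:
  "qint (l + 1) * qint (M - l) = qint l * qint (M - l + 1) + qint (M - 2 * l)"
proof -
  define d p where "d = q - inverse q" and "p = inverse q"
  define u u' w w' where "u = q powi M" and "u' = q powi (- M)"
    and "w = q powi l" and "w' = q powi (- l)"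
  have twice: "q powi (2 * l) = q powi l * q powi l"
    using q_nonzero by (subst power_int_add[symmetric]) simp_all
  have pows: "q powi (l + 1) = w * q" "q powi (- (l + 1)) = w' * p"
    "q powi (M - l) = u * w'" "q powi (- (M - l)) = u' * w"
    "q powi (M - l + 1) = u * w' * q" "q powi (- (M - l + 1)) = u' * w * p"
    "q powi (M - 2 * l) = u * w' * w'" "q powi (- (M - 2 * l)) = u' * w * w"
    using q_nonzero twice
    by (simp_all add: p_def u_def u'_def w_def w'_def power_int_add power_int_diff
        power_int_minus field_simps)
  have "(w * q - w' * p) * (u * w' - u' * w) =
     (w - w') * (u * w' * q - u' * w * p) + (u * w' * w' - u' * w * w) * d"
    by (simp add: d_def p_def algebra_simps)
  then have "(w * q - w' * p) / d * ((u * w' - u' * w) / d) =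
     (w - w') / d * ((u * w' * q - u' * w * p) / d) + (u * w' * w' - u' * w * w) / d"
    using q_diff_nonzero unfolding d_def[symmetric] by (simp add: add_divide_distrib)
  then show ?thesis
    unfolding qint_def d_def[symmetric] pows w_def[symmetric] w'_def[symmetric] .
qed

lemma qbinom_0 [simp]: "qbinom N 0 = 1"
  by (simp add: qbinom_def)

text \<open>Absorption: the first factor of the numerator and the last of the denominator split off,
  and the remaining numerator shifts by one. \<open>N\<close> is any integer because upper entries
  such as n - b + c + x can be negative.\<close>

lemma qint_mult_qbinom_Suc:
  "qint (int (Suc r)) * qbinom (N + 1) (Suc r) = qint (N + 1) * qbinom N r"
proof -
  have *: "qbinom N r = (\<Prod>s = 1..r. qint (N - int s + 1)) / (\<Prod>s = 1..r. qint (int s))" for N r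
    by (simp add: qbinom_def prod_dividef)
  have "(\<Prod>s = 1..Suc r. qint (N + 1 - int s + 1)) =
      qint (N + 1) * (\<Prod>s = Suc 1..Suc r. qint (N + 1 - int s + 1))"
    by (subst prod.atLeast_Suc_atMost) simp_all
  also have "(\<Prod>s = Suc 1..Suc r. qint (N + 1 - int s + 1)) = (\<Prod>s = 1..r. qint (N - int s + 1))"
    by (subst prod.shift_bounds_cl_Suc_ivl) (simp add: algebra_simps)
  finally have "(\<Prod>s = 1..Suc r. qint (N + 1 - int s + 1)) =
      qint (N + 1) * (\<Prod>s = 1..r. qint (N - int s + 1))" .
  moreover have "(\<Prod>s = 1..Suc r. qint (int s)) = qint (int (Suc r)) * (\<Prod>s = 1..r. qint (int s))"
    by (simp add: mult.commute)
  ultimately show ?thesis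
    unfolding * using qint_nonzero[of "Suc r"] by simp
qed


section \<open>Relations in the quantum group\<close>

lemma fscal_mult: "fscal c * fscal d = fscal (c * d)"
  by (simp add: fscal_def mult_single)

lemma fscal_commute: "fscal c * x = x * fscal c"
  by (induction x rule: free_alg_induct)
    (simp_all add: distrib_left distrib_right fscal_def mult_single mult.commute)

lemma uq_eq_refl: "uq_eq x x"
  by (simp add: uq_eq_def uq_ideal.zero)

lemma scal_mult: "scal (c * d) = scal c * scal d"
  by transfer (simp add: fscal_mult uq_eq_refl)

lemma scal_add: "scal (c + d) = scal c + scal d"
  by transfer (simp add: fscal_def single_add uq_eq_refl)

lemma scal_1 [simp]: "scal 1 = 1"
  by transfer (simp add: fscal_def uq_eq_refl)

lemma scal_commute: "scal c * u = u * scal c"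
  by transfer (simp add: fscal_commute uq_eq_refl)

lemma Kinv_K_eq: "Kinv a * K a = 1"
  by transfer (auto simp: uq_eq_def intro!: uq_rels_in_ideal uq_rels.intros)

lemma K_F_eq: "K a * F b = scal (q powi (- cartan a b)) * (F b * K a)"
  by transfer (auto simp: uq_eq_def intro!: uq_rels_in_ideal uq_rels.intros)

lemma E_F_same_eq: "E a * F a = F a * E a + scal (inverse (q - inverse q)) * (K a - Kinv a)"
proof transfer
  fix a
  show "uq_eq (fgen (gE a) * fgen (gF a)) (fgen (gF a) * fgen (gE a) +
      fscal (inverse (q - inverse q)) * (fgen (gK a) - fgen (gKinv a)))"
    using uq_rels_in_ideal[OF uq_rels.E_F_same[of a]] by (simp add: uq_eq_def diff_diff_eq)
qed

lemma E_F_diff_eq: "a \<noteq> b \<Longrightarrow> E a * F b = F b * E a"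
  by transfer (auto simp: uq_eq_def intro!: uq_rels_in_ideal uq_rels.intros)

lemma divpow_0 [simp]: "divpow u 0 = 1"
  by (simp add: divpow_def qfact_def)

lemma divpow_neg: "r < 0 \<Longrightarrow> divpow u r = 0"
  by (simp add: divpow_def)

text \<open>No condition on \<open>r\<close> is required: at \<open>r = -1\<close> the left side
  vanishes, and on the right \<open>qint 0\<close> kills \<open>divpow u 0 = 1\<close>. Recursions
  can therefore cross the boundary freely.\<close>

lemma mult_divpow: "u * divpow u r = scal (qint (r + 1)) * divpow u (r + 1)"
proof -
  consider "r < -1" | "r = -1" | k where "r = int k"
    by (metis int_cases2 linorder_neqE_linordered_idom zle_add1_eq_le add.commute
        add.right_inverse neg_0_less_iff_less nonneg_int_cases not_less)
  then show ?thesis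
  proof cases
    case 1
    then show ?thesis by (simp add: divpow_neg)
  next
    case 2
    have "scal 0 = 0" using scal_add[of 0 0] by simp
    with 2 show ?thesis by (simp add: divpow_neg)
  next
    case (3 k)
    then have nat: "nat (int k + 1) = Suc k" by simp
    have "inverse (qfact k) = qint (r + 1) * inverse (qfact (Suc k))"
      using qint_nonzero[of "Suc k"] 3 by (simp add: qfact_def add.commute)
    then have "u * divpow u r = scal (qint (r + 1) * inverse (qfact (Suc k))) * (u * u ^ k)"
      using 3 by (simp add: divpow_def mult.assoc[symmetric] scal_commute[of _ u])
    then show ?thesis
      using 3 by (simp add: divpow_def nat scal_mult mult.assoc)
  qed
qed

lemma divpow_commute:
  assumes "x * u = u * x"
  shows "x * divpow u r = divpow u r * x"
proof -
  have "x * (scal c * u ^ k) = scal c * u ^ k * x" for c k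
  proof -
    have "x * (scal c * u ^ k) = scal c * (x * u ^ k)"
      by (simp add: scal_commute[of c x] flip: mult.assoc)
    also have "x * u ^ k = u ^ k * x"
      by (rule power_commuting_commutes[OF assms[symmetric], symmetric])
    finally show ?thesis
      by (simp add: mult.assoc)
  qed
  then show ?thesis
    by (simp add: divpow_def)
qed


section \<open>Iterating a rule with two terms\<close>

context Uq_module
begin

text \<open>Gives access to the vector space laws over the ground field, in particular the
  cancellation of nonzero scalars.\<close>

sublocale vec: vector_space "\<lambda>c. act (scal c)"
  by standard (simp_all add: act_add_right act_add_left scal_add scal_mult act_mult act_one)

lemma act_0_right [simp]: "act u 0 = 0"
  using act_add_right[of u 0 0] by simp

lemma act_0_left [simp]: "act 0 x = 0"
  using act_add_left[of 0 0 x] by simp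

lemma act_diff_left: "act (u - w) x = act u x - act w x"
  using act_add_left[of "u - w" w x] by simp

lemma act_sum_right: "act u (\<Sum>i\<in>I. f i) = (\<Sum>i\<in>I. act u (f i))"
  by (induction I rule: infinite_finite_induct) (simp_all add: act_add_right)

lemma act_scal_commute: "act u (act (scal c) x) = act (scal c) (act u x)"
  by (simp add: scal_commute flip: act_mult)

lemma act_divpow_step:
  "act u (act (divpow u r) x) = act (scal (qint (r + 1))) (act (divpow u (r + 1)) x)"
  by (simp add: mult_divpow flip: act_mult)

text \<open>Induction on \<open>a\<close>: after one more application of \<open>u\<close>, a vector
  with \<open>Suc x\<close> lowering steps is reached in two ways, so the claim becomes a recursion
  for scalars. The family \<open>v\<close> has integer indices, so negative exponents need no
  separate treatment.\<close>

lemma divpow_two_term: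
  fixes v :: "int \<Rightarrow> int \<Rightarrow> 'v" and M N c :: int and s :: qfield
  assumes step: "\<And>t l. act u (v t l) = act (scal (qint (t + 1))) (v (t + 1) l)
      + act (scal (s * q powi (2 * t - l - N) * qint (M - l + 1))) (v t (l - 1))"
  shows "act (divpow u (int a)) (v 0 c) = (\<Sum>x = 0..a.
      act (scal (s ^ x * q powi (- (int x * (int x + 1 + 2 * N + 2 * c - 2 * int a) div 2))
        * qbinom (M - c + int x) x)) (v (int a - int x) (c - int x)))"
proof -
  define e where "e a x = - (int x * (int x + 1 + 2 * N + 2 * c - 2 * int a) div 2)" for a x
  define C where "C a x = s ^ x * q powi (e a x) * qbinom (M - c + int x) x" for a x
  define w where "w a x = v (int a - int x) (c - int x)" for a x
  \<comment> \<open>The two factors of the product have opposite parity, so \<open>div 2\<close> is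
    exact and differences of \<open>e\<close> can be found by linear arithmetic.\<close>
  have e_double: "2 * e a x = - (int x * (int x + 1 + 2 * N + 2 * c - 2 * int a))" for a x
    unfolding e_def by simp
  have e_Suc_left: "e (Suc a) x = e a x + int x" for a x
    using e_double[of "Suc a" x] e_double[of a x] by (simp add: algebra_simps)
  have e_Suc_right: "e a x = e a (Suc x) + int x + 1 + N + c - int a" for a x
    using e_double[of a "Suc x"] e_double[of a x] by (simp add: algebra_simps)
  \<comment> \<open>The factor that the lowering summand of the rule contributes on
    \<open>w a x\<close>, where \<open>t = a - x\<close> and \<open>l = c - x\<close>.\<close>
  define D where "D a x = s * q powi (2 * (int a - int x) - (c - int x) - N)
      * qint (M - (c - int x) + 1)" for a x
  have C_0: "C a 0 = 1" for a
    by (simp add: C_def e_def)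
  \<comment> \<open>The two sources of \<open>w (Suc a) (Suc x)\<close>: raising \<open>t\<close> in
    \<open>w a (Suc x)\<close> and lowering \<open>l\<close> in \<open>w a x\<close>. The factor on
    the left is the one produced by \<open>act_divpow_step\<close>.\<close>
  have C_rec: "qint (int (Suc a)) * C (Suc a) (Suc x) =
      qint (int a - int x) * C a (Suc x) + C a x * D a x" for a x
  proof -
    have bin: "qbinom (M - c + int x) x * qint (M - (c - int x) + 1) =
        qint (int (Suc x)) * qbinom (M - c + int (Suc x)) (Suc x)"
      using qint_mult_qbinom_Suc[of x "M - c + int x"] by (simp add: algebra_simps)
    \<comment> \<open>The prescribed exponent of \<open>q\<close> in the rule is such that
      \<open>N\<close>, \<open>c\<close> and \<open>x\<close> cancel, leaving a shift that depends
      on \<open>a\<close> alone.\<close>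
    have pw: "q powi e a x * q powi (2 * (int a - int x) - (c - int x) - N) =
        q powi e a (Suc x) * q powi (int a + 1)"
      using q_nonzero by (simp add: e_Suc_right[of a x] algebra_simps flip: power_int_add)
    have "C a x * D a x = s ^ Suc x *
        (q powi e a x * q powi (2 * (int a - int x) - (c - int x) - N)) *
        (qbinom (M - c + int x) x * qint (M - (c - int x) + 1))"
      by (simp add: C_def D_def mult_ac)
    also have "\<dots> = qint (int (Suc x)) * q powi (int a + 1) * C a (Suc x)"
      by (simp only: bin pw) (simp add: C_def mult_ac)
    finally have CD: "C a x * D a x = qint (int (Suc x)) * q powi (int a + 1) * C a (Suc x)" .
    have "C (Suc a) (Suc x) = q powi int (Suc x) * C a (Suc x)"
      using q_nonzero by (simp add: C_def e_Suc_left power_int_add mult_ac del: of_nat_Suc)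
    \<comment> \<open>The q-Pascal rule: split a + 1 as (a - x) + (x + 1) and multiply by
      \<open>q powi int (Suc x)\<close>.\<close>
    moreover have "qint (int (Suc a)) * q powi int (Suc x) =
        qint (int a - int x) + qint (int (Suc x)) * q powi (int a + 1)"
    proof -
      have "qint (int (Suc a)) =
          qint (int a - int x) * q powi (- int (Suc x)) + qint (int (Suc x)) * q powi (int a - int x)"
        using qint_add[of "int a - int x" "int (Suc x)"] by (simp add: algebra_simps)
      moreover have "q powi (- int (Suc x)) * q powi int (Suc x) = 1"
        using q_nonzero by (subst power_int_add[symmetric]) simp_all
      moreover have "q powi (int a - int x) * q powi int (Suc x) = q powi (int a + 1)"
        using q_nonzero by (subst power_int_add[symmetric]) (simp_all add: algebra_simps)
      ultimately show ?thesis
        by (simp add: distrib_right mult.assoc)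
    qed
    ultimately show ?thesis
      by (simp add: CD algebra_simps)
  qed
  have "act (divpow u (int a)) (v 0 c) = (\<Sum>x = 0..a. act (scal (C a x)) (w a x))"
  proof (induction a)
    case 0
    then show ?case by (simp add: C_0 w_def act_one)
  next
    case (Suc a)
    have step': "act u (act (scal (C a x)) (w a x)) =
        act (scal (qint (int (Suc a) - int x) * C a x)) (w (Suc a) x) +
        act (scal (C a x * D a x)) (w (Suc a) (Suc x))" for x
      unfolding act_scal_commute w_def step
      by (simp add: D_def vec.scale_right_distrib algebra_simps)
    \<comment> \<open>Both sides are compared after scaling by [a + 1], so that no division occurs
      before the final cancellation.\<close>
    have "act (scal (qint (int (Suc a)))) (act (divpow u (int (Suc a))) (v 0 c)) =
        act u (act (divpow u (int a)) (v 0 c))"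
      by (simp add: act_divpow_step add.commute)
    also have "\<dots> = (\<Sum>x = 0..a. act (scal (qint (int (Suc a) - int x) * C a x)) (w (Suc a) x)) +
        (\<Sum>x = 0..a. act (scal (C a x * D a x)) (w (Suc a) (Suc x)))"
      by (simp add: Suc act_sum_right step' sum.distrib)
    \<comment> \<open>The added summand \<open>x = Suc a\<close> carries the factor
      \<open>qint 0\<close>.\<close>
    also have "(\<Sum>x = 0..a. act (scal (qint (int (Suc a) - int x) * C a x)) (w (Suc a) x)) =
        (\<Sum>x = 0..Suc a. act (scal (qint (int (Suc a) - int x) * C a x)) (w (Suc a) x))"
      by simp
    also have "\<dots> = act (scal (qint (int (Suc a)) * C a 0)) (w (Suc a) 0) +
        (\<Sum>x = 0..a. act (scal (qint (int a - int x) * C a (Suc x))) (w (Suc a) (Suc x)))"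
      by (subst sum.atLeast0_atMost_Suc_shift) simp
    also have "\<dots> + (\<Sum>x = 0..a. act (scal (C a x * D a x)) (w (Suc a) (Suc x))) =
        act (scal (qint (int (Suc a)) * C a 0)) (w (Suc a) 0) +
        (\<Sum>x = 0..a. act (scal (qint (int (Suc a)) * C (Suc a) (Suc x))) (w (Suc a) (Suc x)))"
      by (simp only: C_rec vec.scale_left_distrib sum.distrib add.assoc)
    also have "\<dots> = (\<Sum>x = 0..Suc a. act (scal (qint (int (Suc a)) * C (Suc a) x)) (w (Suc a) x))"
      by (subst sum.atLeast0_atMost_Suc_shift) (simp add: C_0)
    also have "\<dots> = act (scal (qint (int (Suc a))))
        (\<Sum>x = 0..Suc a. act (scal (C (Suc a) x)) (w (Suc a) x))"
      by (simp only: vec.scale_sum_right vec.scale_scale)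
    finally show ?case
      by (rule vec.scale_left_imp_eq[OF qint_nonzero[OF zero_less_Suc]])
  qed
  then show ?thesis
    by (simp add: C_def e_def w_def)
qed


section \<open>Weight vectors\<close>

text \<open>The zero vector has every weight, so vanishing divided powers need no exception.\<close>

definition weight :: "vertex \<Rightarrow> int \<Rightarrow> 'v \<Rightarrow> bool" where
  "weight a \<mu> x \<longleftrightarrow> act (K a) x = act (scal (q powi \<mu>)) x"

lemma weight_Kinv:
  assumes "weight a \<mu> x"
  shows "act (Kinv a) x = act (scal (q powi (- \<mu>))) x"
proof -
  have "act (Kinv a) (act (scal (q powi \<mu>)) x) = x"
    unfolding assms[unfolded weight_def, symmetric] by (simp add: Kinv_K_eq act_one flip: act_mult)
  then have "act (scal (q powi (- \<mu>))) x = act (scal (q powi (- \<mu>) * q powi \<mu>)) (act (Kinv a) x)"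
    by (metis act_scal_commute vec.scale_scale)
  then show ?thesis
    using q_nonzero by (simp add: power_int_minus act_one)
qed

lemma weight_scale: "weight a \<mu> x \<Longrightarrow> weight a \<mu> (act (scal c) x)"
  by (simp add: weight_def act_scal_commute[of "K a"])

lemma weight_F:
  assumes "weight a \<mu> x"
  shows "weight a (\<mu> - cartan a b) (act (F b) x)"
proof -
  have "act (K a) (act (F b) x) = act (scal (q powi (- cartan a b))) (act (F b) (act (K a) x))"
    by (simp add: K_F_eq flip: act_mult)
  also have "\<dots> = act (scal (q powi (- cartan a b) * q powi \<mu>)) (act (F b) x)"
    using assms by (simp add: weight_def act_scal_commute[of "F b"])
  also have "q powi (- cartan a b) * q powi \<mu> = q powi (\<mu> - cartan a b)"
    using q_nonzero by (simp flip: power_int_add)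
  finally show ?thesis by (simp add: weight_def)
qed

lemma weight_divpow_F:
  assumes "weight a \<mu> x"
  shows "weight a (\<mu> - r * cartan a b) (act (divpow (F b) r) x)"
proof (cases "r < 0")
  case True
  then show ?thesis by (simp add: divpow_neg weight_def)
next
  case False
  have "weight a (\<mu> - int k * cartan a b) (act (F b ^ k) x)" for k
  proof (induction k)
    case 0
    then show ?case using assms by (simp add: act_one)
  next
    case (Suc k)
    from weight_F[OF this, of b] show ?case
      by (simp add: act_mult algebra_simps)
  qed
  from weight_scale[OF this[of "nat r"]] False show ?thesis
    by (simp add: divpow_def act_mult)
qed

text \<open>The rank one computation: in the induction \<open>E a\<close> is moved past one
  \<open>F a\<close>, the commutator acts by a quantum integer, and \<open>qint_mult_shift\<close>
  merges the two contributions.\<close>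

lemma act_E_divpow_F_same:
  assumes wt: "weight a M x" and hw: "act (E a) x = 0"
  shows "act (E a) (act (divpow (F a) r) x) =
    act (scal (qint (M - r + 1))) (act (divpow (F a) (r - 1)) x)"
proof (cases "r < 0")
  case True
  then show ?thesis by (simp add: divpow_neg)
next
  case False
  have "act (E a) (act (divpow (F a) (int k)) x) =
      act (scal (qint (M - int k + 1))) (act (divpow (F a) (int k - 1)) x)" for k
  proof (induction k)
    case 0
    then show ?case by (simp add: hw act_one divpow_neg)
  next
    case (Suc k)
    let ?y = "act (divpow (F a) (int k)) x"
    have wt_y: "weight a (M - 2 * int k) ?y"
      using weight_divpow_F[OF wt, of "int k" a] by (simp add: cartan_def mult.commute)
    have K_part: "act (scal (inverse (q - inverse q)) * (K a - Kinv a)) ?y =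
        act (scal (qint (M - 2 * int k))) ?y"
    proof -
      have "act (K a - Kinv a) ?y = act (scal (q powi (M - 2 * int k) - q powi (- (M - 2 * int k)))) ?y"
        using wt_y weight_Kinv[OF wt_y]
        by (simp only: act_diff_left weight_def vec.scale_left_diff_distrib)
      then show ?thesis
        by (simp add: act_mult qint_def divide_inverse mult.commute)
    qed
    have E_F: "act (E a) (act (F a) y) =
        act (F a) (act (E a) y) + act (scal (inverse (q - inverse q)) * (K a - Kinv a)) y" for y
      by (simp only: E_F_same_eq act_add_left flip: act_mult)
    have "act (scal (qint (int (Suc k)))) (act (E a) (act (divpow (F a) (int (Suc k))) x)) =
        act (E a) (act (F a) ?y)"
      by (simp add: act_divpow_step act_scal_commute[of "E a"] add.commute)
    also have "\<dots> = act (F a) (act (E a) ?y) + act (scal (qint (M - 2 * int k))) ?y"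
      unfolding E_F K_part ..
    \<comment> \<open>By induction \<open>E a\<close> lowers the exponent to \<open>k - 1\<close>;
      \<open>F a\<close> restores \<open>?y\<close> at the cost of [k].\<close>
    also have "act (F a) (act (E a) ?y) = act (scal (qint (M - int k + 1) * qint (int k))) ?y"
      by (simp add: Suc act_scal_commute[of "F a"] act_divpow_step)
    also have "\<dots> + act (scal (qint (M - 2 * int k))) ?y =
        act (scal (qint (int (Suc k)) * qint (M - int k))) ?y"
      using qint_mult_shift[of "int k" M]
      by (simp add: mult.commute add.commute flip: vec.scale_left_distrib)
    also have "\<dots> = act (scal (qint (int (Suc k)))) (act (scal (qint (M - int k))) ?y)"
      by simp
    finally have "act (E a) (act (divpow (F a) (int (Suc k))) x) =
        act (scal (qint (M - int k))) ?y"
      by (rule vec.scale_left_imp_eq[OF qint_nonzero[OF zero_less_Suc]])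
    then show ?case by simp
  qed
  from this[of "nat r"] False show ?thesis by simp
qed

lemma act_E_divpow_F_diff:
  assumes "a \<noteq> b"
  shows "act (E a) (act (divpow (F b) r) x) = act (divpow (F b) r) (act (E a) x)"
  using divpow_commute[OF E_F_diff_eq[OF assms]] by (simp flip: act_mult)

text \<open>
  Both \<open>B\<^sub>1\<close> (\<open>i = 1\<close>, \<open>j = 2\<close>) and \<open>B\<^sub>2\<close> (\<open>i = 2\<close>, \<open>j = 1\<close>) are of the form considered here.
\<close>

lemma divpow_B_expansion:
  assumes "i \<noteq> j" and wt_i: "weight i N x" and wt_j: "weight j M x" and hw: "act (E j) x = 0"
  shows "act (divpow (F i + scal s * (E j * Kinv i)) (int a)) (act (divpow (F j) c) x) =
    (\<Sum>z = 0..a. act (scal (s ^ z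
        * q powi (- (int z * (int z + 1 + 2 * N + 2 * c - 2 * int a) div 2))
        * qbinom (M - c + int z) z))
      (act (divpow (F i) (int a - int z)) (act (divpow (F j) (c - int z)) x)))"
proof -
  define v where "v t l = act (divpow (F i) t) (act (divpow (F j) l) x)" for t l
  have step: "act (F i + scal s * (E j * Kinv i)) (v t l) =
      act (scal (qint (t + 1))) (v (t + 1) l) +
      act (scal (s * q powi (2 * t - l - N) * qint (M - l + 1))) (v t (l - 1))" for t l
  proof -
    \<comment> \<open>Each \<open>F j\<close> raises the \<open>i\<close>-weight by 1 and each
      \<open>F i\<close> lowers it by 2; \<open>Kinv i\<close> turns this into the power of
      \<open>q\<close> in the rule.\<close>
    have "weight i (N + l - 2 * t) (v t l)"
      using weight_divpow_F[OF weight_divpow_F[OF wt_i, of l j], of t i] \<open>i \<noteq> j\<close>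
      by (simp add: v_def cartan_def algebra_simps)
    from weight_Kinv[OF this]
    have "act (Kinv i) (v t l) = act (scal (q powi (2 * t - l - N))) (v t l)"
      by (simp add: algebra_simps)
    moreover have "act (E j) (v t l) = act (scal (qint (M - l + 1))) (v t (l - 1))"
      using \<open>i \<noteq> j\<close>
      by (simp add: v_def act_E_divpow_F_diff act_E_divpow_F_same[OF wt_j hw]
          act_scal_commute[of "divpow (F i) t"])
    ultimately show ?thesis
      by (simp add: act_add_left act_mult act_scal_commute[of "E j"])
        (simp add: v_def act_divpow_step mult_ac)
  qed
  have "act (divpow (F i + scal s * (E j * Kinv i)) (int a)) (v 0 c) =
    (\<Sum>z = 0..a. act (scal (s ^ z
        * q powi (- (int z * (int z + 1 + 2 * N + 2 * c - 2 * int a) div 2))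
        * qbinom (M - c + int z) z)) (v (int a - int z) (c - int z)))"
    by (rule divpow_two_term) (rule step)
  then show ?thesis by (simp add: v_def act_one)
qed

end

section \<open>The product of three divided powers on the highest weight vector\<close>

theorem proposition5p9:
  fixes act :: "Uq \<Rightarrow> 'v::ab_group_add \<Rightarrow> 'v"
    and \<eta> :: 'v
    and m n a b c :: nat
    and \<sigma>1 \<sigma>2 :: qfield
  assumes "L_module act m n \<eta>"
    and "\<sigma>1 \<noteq> 0" and "\<sigma>2 \<noteq> 0"
    and "b \<ge> a + c"
  shows
    "act (divpow (B1 \<sigma>1) (int a) * divpow (B2 \<sigma>2) (int b) * divpow (B1 \<sigma>1) (int c)) \<eta> =
      (\<Sum>t = 0..a. \<Sum>l = b - c..b.
        act (scal (\<sigma>1 ^ (a - t) * \<sigma>2 ^ (b - l)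
              * q powi (- ((int b - int l) * (- int b - int l + 1 + 2 * int c + 2 * int n) div 2)
                        - ((int a - int t) * (2 * int m + 4 * int b - 4 * int c - 2 * int l
                             - int a - int t + 1) div 2))
              * qbinom (int n + int a - int t - int b + int c) (a - t)
              * qbinom (int m - int c + int b - int l) (b - l))
            * (divpow (F v1) (int t) * divpow (F v2) (int l - int a + int t)
              * divpow (F v1) (int c - int b + int l))) \<eta>)
    \<and>
    act (divpow (B1 \<sigma>1) (int a) * divpow (B2 \<sigma>2) (int b) * divpow (B1 \<sigma>1) (int c)) \<eta> =
      (\<Sum>x = 0..a. \<Sum>y = 0..c.
        act (scal (\<sigma>1 ^ x * \<sigma>2 ^ y
              * q powi (- (int y * (int y + 1 + 2 * int n + 2 * int c - 2 * int b) div 2)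
                        - (int x * (int x + 1 + 2 * int m + 2 * int b - 4 * int c - 2 * int a
                             + 2 * int y) div 2))
              * qbinom (int n - int b + int c + int x) x
              * qbinom (int m - int c + int y) y)
            * (divpow (F v1) (int a - int x) * divpow (F v2) (int b - int x - int y)
              * divpow (F v1) (int c - int y))) \<eta>)"
proof -
  interpret L_module act m n \<eta> by fact
  let ?F = "\<lambda>i r. act (divpow (F i) r)"
  define R where "R x y = act (scal (\<sigma>1 ^ x * \<sigma>2 ^ y
              * q powi (- (int y * (int y + 1 + 2 * int n + 2 * int c - 2 * int b) div 2)
                        - (int x * (int x + 1 + 2 * int m + 2 * int b - 4 * int c - 2 * int a
                             + 2 * int y) div 2))
              * qbinom (int n - int b + int c + int x) x
              * qbinom (int m - int c + int y) y)
            * (divpow (F v1) (int a - int x) * divpow (F v2) (int b - int x - int y)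
              * divpow (F v1) (int c - int y))) \<eta>" for x y
  have wt1: "weight v1 (int m) \<eta>" and wt2: "weight v2 (int n) \<eta>"
    using K1_\<eta> K2_\<eta> by (simp_all add: weight_def)
  \<comment> \<open>The expansion is used with inner exponent 0: every term \<open>z > 0\<close>
    contains a negative divided power of \<open>F v2\<close> and vanishes.\<close>
  have B1_c: "act (divpow (B1 \<sigma>1) (int c)) \<eta> = ?F v1 (int c) \<eta>"
  proof -
    have "act (divpow (B1 \<sigma>1) (int c)) \<eta> = (\<Sum>z = 0..c. act (scal (\<sigma>1 ^ z
        * q powi (- (int z * (int z + 1 + 2 * int m + 2 * 0 - 2 * int c) div 2))
        * qbinom (int n - 0 + int z) z)) (?F v1 (int c - int z) (?F v2 (0 - int z) \<eta>)))"
      using divpow_B_expansion[OF _ wt1 wt2 E_\<eta>, of \<sigma>1 c 0] by (simp add: B1_def act_one)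
    also have "\<dots> = ?F v1 (int c) \<eta>"
      by (subst sum.atLeast_Suc_atMost) (simp_all add: act_one divpow_neg)
    finally show ?thesis .
  qed
  have B2_b: "act (divpow (B2 \<sigma>2) (int b)) (?F v1 (int c) \<eta>) =
      (\<Sum>y = 0..c. act (scal (\<sigma>2 ^ y
        * q powi (- (int y * (int y + 1 + 2 * int n + 2 * int c - 2 * int b) div 2))
        * qbinom (int m - int c + int y) y))
        (?F v2 (int b - int y) (?F v1 (int c - int y) \<eta>)))" (is "_ = sum ?g _")
  proof -
    have "act (divpow (B2 \<sigma>2) (int b)) (?F v1 (int c) \<eta>) = sum ?g {0..b}"
      using divpow_B_expansion[OF _ wt2 wt1 E_\<eta>, of \<sigma>2 b "int c"] by (simp add: B2_def)
    \<comment> \<open>Terms with \<open>y > c\<close> contain a negative divided power of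
      \<open>F v1\<close>.\<close>
    also have "\<dots> = sum ?g {0..c}"
      using \<open>b \<ge> a + c\<close> by (intro sum.mono_neutral_right) (auto simp: divpow_neg)
    finally show ?thesis .
  qed
  have B1_a: "act (divpow (B1 \<sigma>1) (int a)) (?g y) = (\<Sum>x = 0..a. R x y)" for y
  proof -
    define k where "k = int c - int y"
    \<comment> \<open>For the outer factor this vector replaces the highest weight vector: its
      weights are known and it is still killed by \<open>E v2\<close>, the only raising generator
      occurring in \<open>B1\<close>.\<close>
    have wt1': "weight v1 (int m - 2 * k) (?F v1 k \<eta>)"
      and wt2': "weight v2 (int n + k) (?F v1 k \<eta>)"
      using weight_divpow_F[OF wt1, of k v1] weight_divpow_F[OF wt2, of k v1]
      by (simp_all add: cartan_def mult.commute)
    have hw': "act (E v2) (?F v1 k \<eta>) = 0"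
      by (simp add: act_E_divpow_F_diff E_\<eta>)
    show ?thesis
      unfolding act_scal_commute
      unfolding B1_def
      \<comment> \<open>With inner exponent b - y, the upper entry n + k - (b - y) + x equals n - b
        + c + x, free of y, while 2(m - 2k) + 2(b - y) equals 2m + 2b - 4c + 2y.\<close>
      unfolding k_def[symmetric]
        divpow_B_expansion[OF _ wt1' wt2' hw', of \<sigma>1 a "int b - int y", simplified]
        vec.scale_sum_right
      by (intro sum.cong refl)
        (simp add: R_def k_def act_mult power_int_add power_int_diff power_int_minus q_nonzero algebra_simps)
  qed
  have second: "act (divpow (B1 \<sigma>1) (int a) * divpow (B2 \<sigma>2) (int b) * divpow (B1 \<sigma>1) (int c)) \<eta> =
      (\<Sum>x = 0..a. \<Sum>y = 0..c. R x y)"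
    unfolding act_mult B1_c B2_b act_sum_right B1_a by (rule sum.swap)
  \<comment> \<open>The substitution x = a - t, y = b - l; the truncated difference
    \<open>b - c\<close> is exact because c is at most b.\<close>
  have "(\<Sum>x = 0..a. \<Sum>y = 0..c. R x y) = (\<Sum>t = 0..a. \<Sum>l = b - c..b. R (a - t) (b - l))"
  proof (rule sum.reindex_bij_witness[where i = "\<lambda>t. a - t" and j = "\<lambda>x. a - x"])
    fix x assume "x \<in> {0..a}"
    have "(\<Sum>y = 0..c. R x y) = (\<Sum>l = b - c..b. R x (b - l))"
      using \<open>b \<ge> a + c\<close>
      by (intro sum.reindex_bij_witness[where i = "\<lambda>l. b - l" and j = "\<lambda>y. b - y"]) auto
    then show "(\<Sum>l = b - c..b. R (a - (a - x)) (b - l)) = (\<Sum>y = 0..c. R x y)"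
      using \<open>x \<in> {0..a}\<close> by simp
  qed auto
  also have "\<dots> = (\<Sum>t = 0..a. \<Sum>l = b - c..b.
        act (scal (\<sigma>1 ^ (a - t) * \<sigma>2 ^ (b - l)
              * q powi (- ((int b - int l) * (- int b - int l + 1 + 2 * int c + 2 * int n) div 2)
                        - ((int a - int t) * (2 * int m + 4 * int b - 4 * int c - 2 * int l
                             - int a - int t + 1) div 2))
              * qbinom (int n + int a - int t - int b + int c) (a - t)
              * qbinom (int m - int c + int b - int l) (b - l))
            * (divpow (F v1) (int t) * divpow (F v2) (int l - int a + int t)
              * divpow (F v1) (int c - int b + int l))) \<eta>)"
  proof (intro sum.cong refl, goal_cases)
    case (1 t l)
    \<comment> \<open>Writing \<open>a\<close> and \<open>b\<close> as sums removes truncated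
      subtraction, after which the two summands agree by ring normalisation.\<close>
    then obtain x y where "a = t + x" "b = l + y"
      by (auto simp: le_iff_add)
    then show ?case
      by (simp add: R_def algebra_simps)
  qed
  finally show ?thesis
    using second unfolding R_def by simp
qed

end
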